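(* Let $N$ be a positive integer, let $B$ be the $N\times N$ real upper bidiagonal matrix with diagonal entries $\sqrt{q_1},\dots,\sqrt{q_N}$ and upper subdiagonal entries $\sqrt{e_1},\dots,\sqrt{e_{N-1}}$, where all $q_i>0$ and $e_i>0$. Let $W=(W_{i,j})$ denote the matrix $(BB^{\top})^{-1}$. Let $\tilde g_i^{(M)}$ ($i=1,\dots,N$, $M=1,2,\dots$) be the quantities defined recursively in the context. Then for all $i=1,\dots,N$, $$\tilde g_i^{(2)}=\sum_{j_1=1}^{i-1}W_{i,j_1}W_{j_1,i},$$ $$\tilde g_i^{(3)}=\sum_{j_1=1}^{i-1}\sum_{j_2=1}^{i-1}W_{i,j_1}W_{j_1,j_2}W_{j_2,i},$$ $$\tilde g_i^{(M)}=\sum_{j_1=1}^{i-1}\cdots\sum_{j_{M-1}=1}^{i-1}W_{i,j_1}W_{j_1,j_2}\cdots W_{j_{M-2},j_{M-1}}W_{j_{M-1},i},\qquad M=4,5,\dots.$$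
   Context: The matrix $B$ has $(i,i)$-entry $\sqrt{q_i}$ ($i=1,\dots,N$), $(i,i+1)$-entry $\sqrt{e_i}$ ($i=1,\dots,N-1$), and all other entries zero. Convention: $\sum_{i=j}^{k}=0$ if $j>k$. Put $\check B_i=1/q_i$ for $i=1,\dots,N$ and $\tilde F_i=e_{i-1}/q_i$ for $i=2,\dots,N$. Let $w_i^{(1)}$ denote the $(i,i)$-entry of $(BB^{\top})^{-1}$. The quantities $\tilde g_i^{(r)}$ for $i=1,\dots,N$ and $r=1,2,\dots$ are defined by: - $\tilde g_1^{(r)}=0$ for every positive integer $r$; - $\tilde g_i^{(1)}=\tilde F_i\,w_{i-1}^{(1)}$ for $i=2,\dots,N$; - $\tilde g_i^{(r)}=\tilde F_i\,\tilde g_{i-1}^{(r)}+\check B_{i-1}\,\tilde g_i^{(r-1)}+\sum_{k=1}^{r-1}\tilde g_{i-1}^{(k)}\,\tilde g_i^{(r-k)}$ for $i=2,\dots,N$ and $r=2,3,\dots$. *)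

theory Defs
  imports
    "Jordan_Normal_Form.Gauss_Jordan_Elimination"
    "Jordan_Normal_Form.Determinant"
    Complex_Main
    "HOL-Library.FuncSet"
begin

(* The sequences q, e and all indices i, j below are 1-based; only q 1, ..., q N and
   e 1, ..., e (N - 1) are relevant. The matrix type itself is indexed from 0. *)

definition B_mat :: "nat \<Rightarrow> (nat \<Rightarrow> real) \<Rightarrow> (nat \<Rightarrow> real) \<Rightarrow> real mat" where
  "B_mat N q e = mat N N (\<lambda>(i, j).
     if j = i then sqrt (q (i + 1)) else if j = i + 1 then sqrt (e (i + 1)) else 0)"

definition W_mat :: "nat \<Rightarrow> (nat \<Rightarrow> real) \<Rightarrow> (nat \<Rightarrow> real) \<Rightarrow> real mat" where
  "W_mat N q e = the (mat_inverse (B_mat N q e * transpose_mat (B_mat N q e)))"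

definition W :: "nat \<Rightarrow> (nat \<Rightarrow> real) \<Rightarrow> (nat \<Rightarrow> real) \<Rightarrow> nat \<Rightarrow> nat \<Rightarrow> real" where
  "W N q e i j = W_mat N q e $$ (i - 1, j - 1)"

definition B_check :: "(nat \<Rightarrow> real) \<Rightarrow> nat \<Rightarrow> real" where
  "B_check q i = 1 / q i"

definition F_tilde :: "(nat \<Rightarrow> real) \<Rightarrow> (nat \<Rightarrow> real) \<Rightarrow> nat \<Rightarrow> real" where
  "F_tilde q e i = e (i - 1) / q i"

(* The value 0 for i = 0 or r = 0 lies outside the intended range i, r \<ge> 1 and is never used
   by the recursion within that range. *)
fun g_tilde :: "nat \<Rightarrow> (nat \<Rightarrow> real) \<Rightarrow> (nat \<Rightarrow> real) \<Rightarrow> nat \<Rightarrow> nat \<Rightarrow> real" where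
  "g_tilde N q e i r =
     (if i \<le> 1 \<or> r = 0 then 0
      else if r = 1 then F_tilde q e i * W N q e (i - 1) (i - 1)
      else F_tilde q e i * g_tilde N q e (i - 1) r
         + B_check q (i - 1) * g_tilde N q e i (r - 1)
         + (\<Sum>k = 1..r - 1. g_tilde N q e (i - 1) k * g_tilde N q e i (r - k)))"

declare g_tilde.simps [simp del]

lemma g_tilde_1: "g_tilde N q e 1 r = 0"
  by (simp add: g_tilde.simps)

lemma g_tilde_r1:
  "2 \<le> i \<Longrightarrow> g_tilde N q e i 1 = F_tilde q e i * W N q e (i - 1) (i - 1)"
  by (simp add: g_tilde.simps)

lemma g_tilde_rec:
  assumes "2 \<le> i" "2 \<le> r"
  shows "g_tilde N q e i r = F_tilde q e i * g_tilde N q e (i - 1) r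
     + B_check q (i - 1) * g_tilde N q e i (r - 1)
     + (\<Sum>k = 1..r - 1. g_tilde N q e (i - 1) k * g_tilde N q e i (r - k))"
  using assms by (subst g_tilde.simps) simp

(* mat_inverse returns an option; the following shows that it succeeds here. *)
lemma W_mat_inverse:
  fixes N :: nat and q e :: "nat \<Rightarrow> real"
  assumes q: "\<And>i. 1 \<le> i \<Longrightarrow> i \<le> N \<Longrightarrow> q i > 0"
  defines "A \<equiv> B_mat N q e * transpose_mat (B_mat N q e)"
  shows "W_mat N q e \<in> carrier_mat N N" "A * W_mat N q e = 1\<^sub>m N" "W_mat N q e * A = 1\<^sub>m N"
proof -
  have B: "B_mat N q e \<in> carrier_mat N N" by (simp add: B_mat_def)
  then have A: "A \<in> carrier_mat N N" by (simp add: A_def)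
  have "upper_triangular (B_mat N q e)"
    by (auto simp: B_mat_def upper_triangular_def)
  then have "det (B_mat N q e) = prod_list (diag_mat (B_mat N q e))"
    using B by (rule det_upper_triangular)
  moreover have "0 \<notin> set (diag_mat (B_mat N q e))"
  proof
    assume "0 \<in> set (diag_mat (B_mat N q e))"
    then obtain i where "i < N" "q (Suc i) = 0" by (auto simp: diag_mat_def B_mat_def)
    then show False using q[of "Suc i"] by simp
  qed
  ultimately have "det (B_mat N q e) \<noteq> 0" by (simp add: prod_list_zero_iff)
  then have "det A \<noteq> 0"
    unfolding A_def using B by (simp add: det_mult[of _ N] det_transpose[of _ N])
  then have "A \<in> Units (ring_mat TYPE(real) N ())"
    using A by (rule det_non_zero_imp_unit[rotated])
  then obtain C where C: "mat_inverse A = Some C"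
    using mat_inverse(1)[OF A, where b = "()"] by (cases "mat_inverse A") auto
  have "W_mat N q e = C" using C by (simp add: W_mat_def A_def)
  then show "W_mat N q e \<in> carrier_mat N N" "A * W_mat N q e = 1\<^sub>m N" "W_mat N q e * A = 1\<^sub>m N"
    using mat_inverse(2)[OF A C] by auto
qed

end

theory Submission
  imports Defs
begin

text \<open>Write \<open>h m r\<close> (formally \<open>walks W m r m\<close>) for the \<open>(m,m)\<close>-entry of the \<open>r\<close>-th power of the leading \<open>m \<times> m\<close> block of \<open>W\<close>.
  Since \<open>B\<close> is bidiagonal, the part of column \<open>m\<close> of \<open>W\<close> above the diagonal is \<open>- sqrt (F_tilde m)\<close> times
  the corresponding part of column \<open>m - 1\<close>. Hence the right-hand sides of the theorem all equal
  \<open>F_tilde i * h (i - 1) M\<close>, and the recursion for \<open>g_tilde\<close> becomes the first-return decomposition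
  of the walks from \<open>m\<close> to \<open>m\<close> that stay in \<open>{1..m}\<close>.\<close>

section \<open>Sums over index tuples as iterated matrix-vector products\<close>

definition walk_step :: "'a set \<Rightarrow> ('a \<Rightarrow> 'a \<Rightarrow> 'b::comm_semiring_1) \<Rightarrow> ('a \<Rightarrow> 'b) \<Rightarrow> 'a \<Rightarrow> 'b" where
  "walk_step A K y = (\<lambda>a. \<Sum>b\<in>A. K a b * y b)"

text \<open>Summing over the last index of the tuple first replaces \<open>y\<close> by
  \<open>walk_step A K y\<close> and shortens the tuple by one, so the induction needs
  \<open>y\<close> arbitrary.\<close>

lemma sum_PiE_walks:
  fixes K :: "'a \<Rightarrow> 'a \<Rightarrow> 'b::comm_semiring_1"
  shows "(\<Sum>j\<in>{1..Suc n} \<rightarrow>\<^sub>E A. x (j 1) * (\<Prod>k = 1..n. K (j k) (j (k + 1))) * y (j (Suc n)))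
       = (\<Sum>a\<in>A. x a * (walk_step A K ^^ n) y a)"
proof (induction n arbitrary: y)
  case 0
  have "(\<Sum>j\<in>{1::nat} \<rightarrow>\<^sub>E A. x (j 1) * y (j 1)) = (\<Sum>a\<in>A. x a * y a)"
    by (rule sum.reindex_bij_witness
        [where i = "\<lambda>a. \<lambda>k\<in>{1::nat}. a" and j = "\<lambda>j. j 1"])
      (auto simp: PiE_iff restrict_def extensional_def)
  then show ?case by simp
next
  case (Suc n)
  let ?p = "\<lambda>j. x (j 1) * (\<Prod>k = 1..n. K (j k) (j (k + 1)))"
  let ?I = "{1..Suc n}" and ?m = "Suc (Suc n)"
  have ins: "{1..?m} = insert ?m ?I" by auto
  have inj: "inj_on (\<lambda>(b, j). j(?m := b)) (A \<times> (?I \<rightarrow>\<^sub>E A))"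
    by (rule inj_combinator) simp
  have "(\<Sum>j\<in>{1..?m} \<rightarrow>\<^sub>E A. x (j 1) * (\<Prod>k = 1..Suc n. K (j k) (j (k + 1))) * y (j ?m))
      = (\<Sum>(b, j)\<in>A \<times> (?I \<rightarrow>\<^sub>E A). ?p j * K (j (Suc n)) b * y b)"
    unfolding ins PiE_insert_eq
    by (subst sum.reindex[OF inj]) (auto intro!: sum.cong prod.cong simp: mult.assoc)
  also have "\<dots> = (\<Sum>b\<in>A. \<Sum>j\<in>?I \<rightarrow>\<^sub>E A. ?p j * K (j (Suc n)) b * y b)"
    by (simp add: sum.cartesian_product)
  also have "\<dots> = (\<Sum>j\<in>?I \<rightarrow>\<^sub>E A. ?p j * walk_step A K y (j (Suc n)))"
    unfolding walk_step_def sum_distrib_left by (subst sum.swap) (simp add: mult.assoc)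
  also have "\<dots> = (\<Sum>a\<in>A. x a * (walk_step A K ^^ n) (walk_step A K y) a)"
    by (rule Suc.IH)
  finally show ?case by (simp add: funpow_swap1)
qed

section \<open>Walks ending at the top vertex of a leading block, and first return\<close>

text \<open>For \<open>j\<close> in \<open>{1..m}\<close> this is the \<open>(j,m)\<close>-entry of
  the \<open>r\<close>-th power of the leading \<open>m\<close>-block of \<open>K\<close>. The start
  \<open>j\<close> stays free so that the first step of a walk can be split off.\<close>

definition walks :: "(nat \<Rightarrow> nat \<Rightarrow> 'a::comm_semiring_1) \<Rightarrow> nat \<Rightarrow> nat \<Rightarrow> nat \<Rightarrow> 'a" where
  "walks K m r = (walk_step {1..m} K ^^ r) (\<lambda>j. of_bool (j = m))"

lemma walks_0: "walks K m 0 j = of_bool (j = m)"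
  by (simp add: walks_def)

lemma walks_Suc: "walks K m (Suc r) j = (\<Sum>l = 1..m. K j l * walks K m r l)"
  by (simp add: walks_def walk_step_def)

lemma walks_1: "1 \<le> m \<Longrightarrow> walks K m 1 j = K j m"
  by (simp add: walks_Suc walks_0 of_bool_def if_distrib[of "(*) _"] sum.delta cong: if_cong)

text \<open>Cut the walk at its first visit to \<open>m\<close>, at time \<open>k\<close>. Up to
  then it stays below \<open>m\<close>, and by \<open>col\<close> its step into \<open>m\<close>
  weighs \<open>c\<close> times the step into \<open>m - 1\<close>; what remains is a walk of length
  \<open>r - k\<close> from \<open>m\<close> to \<open>m\<close>.\<close>

lemma walks_below:
  assumes "2 \<le> m" and col: "\<And>j. 1 \<le> j \<Longrightarrow> j < m \<Longrightarrow> K j m = c * K j (m - 1)"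
    and "1 \<le> j" "j < m"
  shows "walks K m r j = (\<Sum>k = 1..r. c * walks K (m - 1) k j * walks K m (r - k) m)"
  using assms(3,4)
proof (induction r arbitrary: j)
  case 0
  then show ?case by (simp add: walks_0)
next
  case (Suc r)
  have m: "{1..m} = insert m {1..m - 1}" using assms(1) by auto
  have "(\<Sum>l = 1..m - 1. K j l * walks K m r l)
      = (\<Sum>l = 1..m - 1. \<Sum>k = 1..r. c * (K j l * walks K (m - 1) k l) * walks K m (r - k) m)"
    by (intro sum.cong refl, subst Suc.IH) (auto simp: sum_distrib_left mult_ac)
  also have "\<dots> = (\<Sum>k = 1..r. c * walks K (m - 1) (Suc k) j * walks K m (r - k) m)"
    unfolding walks_Suc sum_distrib_left sum_distrib_right by (rule sum.swap)
  \<comment> \<open>The extra step from \<open>j\<close> to \<open>l\<close> delays the first visit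
    by one.\<close>
  also have "\<dots> = (\<Sum>k = 2..Suc r. c * walks K (m - 1) k j * walks K m (Suc r - k) m)"
    using sum.shift_bounds_cl_Suc_ivl
      [of "\<lambda>k. c * walks K (m - 1) k j * walks K m (Suc r - k) m" 1 r, symmetric]
    by (simp add: numeral_2_eq_2)
  finally have below: "(\<Sum>l = 1..m - 1. K j l * walks K m r l) = \<dots>" .
  \<comment> \<open>The direct step to \<open>m\<close> supplies the missing term
    \<open>k = 1\<close>.\<close>
  have "K j m = c * walks K (m - 1) 1 j"
    using assms(1) Suc.prems by (simp add: walks_1 col del: One_nat_def)
  then have "walks K m (Suc r) j = c * walks K (m - 1) 1 j * walks K m r m
      + (\<Sum>k = 2..Suc r. c * walks K (m - 1) k j * walks K m (Suc r - k) m)"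
    unfolding walks_Suc[of K m] m below[symmetric] using assms(1) by (subst sum.insert) auto
  then show ?case
    by (subst sum.atLeast_Suc_atMost) (simp_all add: numeral_2_eq_2 del: sum.cl_ivl_Suc)
qed

text \<open>Split by the time \<open>k\<close> of the first return to \<open>m\<close>. For
  \<open>k > 1\<close>, leaving and re-entering \<open>m\<close> each cost a factor \<open>c\<close>
  and leave a closed walk at \<open>m - 1\<close> inside \<open>{1..m - 1}\<close>. For
  \<open>k = 1\<close>, \<open>diag\<close> splits the loop at \<open>m\<close> into a term of the
  same shape and the extra weight \<open>d\<close>.\<close>

lemma walks_first_return:
  assumes "2 \<le> m" and col: "\<And>j. 1 \<le> j \<Longrightarrow> j < m \<Longrightarrow> K j m = c * K j (m - 1)"
    and row: "\<And>j. 1 \<le> j \<Longrightarrow> j < m \<Longrightarrow> K m j = c * K (m - 1) j"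
    and diag: "K m m = c\<^sup>2 * K (m - 1) (m - 1) + d"
  shows "walks K m (Suc r) m = d * walks K m r m
     + (\<Sum>k = 1..Suc r. c\<^sup>2 * walks K (m - 1) k (m - 1) * walks K m (Suc r - k) m)"
proof -
  have m: "{1..m} = insert m {1..m - 1}" using assms(1) by auto
  have "(\<Sum>l = 1..m - 1. K m l * walks K m r l)
      = (\<Sum>l = 1..m - 1. \<Sum>k = 1..r. c\<^sup>2 * (K (m - 1) l * walks K (m - 1) k l) * walks K m (r - k) m)"
    by (intro sum.cong refl, subst walks_below[OF assms(1) col])
      (auto simp: row sum_distrib_left mult_ac power2_eq_square)
  also have "\<dots> = (\<Sum>k = 1..r. c\<^sup>2 * walks K (m - 1) (Suc k) (m - 1) * walks K m (r - k) m)"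
    unfolding walks_Suc sum_distrib_left sum_distrib_right by (rule sum.swap)
  also have "\<dots> = (\<Sum>k = 2..Suc r. c\<^sup>2 * walks K (m - 1) k (m - 1) * walks K m (Suc r - k) m)"
    using sum.shift_bounds_cl_Suc_ivl
      [of "\<lambda>k. c\<^sup>2 * walks K (m - 1) k (m - 1) * walks K m (Suc r - k) m" 1 r, symmetric]
    by (simp add: numeral_2_eq_2)
  finally have below: "(\<Sum>l = 1..m - 1. K m l * walks K m r l) = \<dots>" .
  have "K m m = c\<^sup>2 * walks K (m - 1) 1 (m - 1) + d"
    using assms(1) by (simp add: walks_1 diag del: One_nat_def)
  then have "walks K m (Suc r) m = (c\<^sup>2 * walks K (m - 1) 1 (m - 1) + d) * walks K m r m
      + (\<Sum>k = 2..Suc r. c\<^sup>2 * walks K (m - 1) k (m - 1) * walks K m (Suc r - k) m)"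
    unfolding walks_Suc[of K m] m below[symmetric] using assms(1) by (subst sum.insert) auto
  then show ?thesis
    by (subst sum.atLeast_Suc_atMost) (simp_all add: numeral_2_eq_2 algebra_simps del: sum.cl_ivl_Suc)
qed

section \<open>Entries of W from the bidiagonal shape of B\<close>

lemma B_mat_carrier: "B_mat N q e \<in> carrier_mat N N"
  by (simp add: B_mat_def)

lemma mult_B_mat_index:
  assumes "M \<in> carrier_mat N N" "k < N" "j < N"
  shows "(M * B_mat N q e) $$ (k, j) = M $$ (k, j) * sqrt (q (j + 1))
     + (if j = 0 then 0 else M $$ (k, j - 1) * sqrt (e j))"
proof -
  have "(M * B_mat N q e) $$ (k, j) = (\<Sum>l = 0..<N. M $$ (k, l) * B_mat N q e $$ (l, j))"
    using assms B_mat_carrier[of N q e] by (simp add: scalar_prod_def)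
  \<comment> \<open>At \<open>j = 0\<close> the index \<open>j - 1\<close> truncates to 0; the inner
    conditional cancels this spurious term.\<close>
  also have "\<dots> = (\<Sum>l = 0..<N. (if l = j then M $$ (k, j) * sqrt (q (j + 1)) else 0)
      + (if l = j - 1 then (if j = 0 then 0 else M $$ (k, j - 1) * sqrt (e j)) else 0))"
    using assms by (intro sum.cong) (auto simp: B_mat_def)
  also have "\<dots> = M $$ (k, j) * sqrt (q (j + 1))
     + (if j = 0 then 0 else M $$ (k, j - 1) * sqrt (e j))"
    using assms unfolding sum.distrib by (subst (1 2) sum.delta) auto
  finally show ?thesis .
qed

lemma mult_transpose_B_mat_index:
  assumes "M \<in> carrier_mat N N" "k < N" "j < N"
  shows "(M * transpose_mat (B_mat N q e)) $$ (k, j) = M $$ (k, j) * sqrt (q (j + 1))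
     + (if j + 1 = N then 0 else M $$ (k, j + 1) * sqrt (e (j + 1)))"
proof -
  have "(M * transpose_mat (B_mat N q e)) $$ (k, j)
      = (\<Sum>l = 0..<N. M $$ (k, l) * B_mat N q e $$ (j, l))"
    using assms B_mat_carrier[of N q e] by (simp add: scalar_prod_def)
  \<comment> \<open>For \<open>j + 1 = N\<close> the second index falls outside the range of
    summation.\<close>
  also have "\<dots> = (\<Sum>l = 0..<N. (if l = j then M $$ (k, j) * sqrt (q (j + 1)) else 0)
      + (if l = j + 1 then M $$ (k, j + 1) * sqrt (e (j + 1)) else 0))"
    using assms by (intro sum.cong) (auto simp: B_mat_def)
  also have "\<dots> = M $$ (k, j) * sqrt (q (j + 1))
     + (if j + 1 = N then 0 else M $$ (k, j + 1) * sqrt (e (j + 1)))"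
    using assms unfolding sum.distrib by (subst (1 2) sum.delta) auto
  finally show ?thesis .
qed

context
  fixes N :: nat and q e :: "nat \<Rightarrow> real"
  assumes q: "\<And>i. 1 \<le> i \<Longrightarrow> i \<le> N \<Longrightarrow> q i > 0"
begin

lemma W_mat_inverses:
  "W_mat N q e \<in> carrier_mat N N"
  "B_mat N q e * transpose_mat (B_mat N q e) * W_mat N q e = 1\<^sub>m N"
  "W_mat N q e * (B_mat N q e * transpose_mat (B_mat N q e)) = 1\<^sub>m N"
  using W_mat_inverse[of N q e] q by auto

text \<open>The transpose of \<open>W\<close> is also a left inverse of the symmetric matrix
  \<open>B B^T\<close>, and a left inverse agrees with a right inverse.\<close>

lemma W_mat_symmetric: "transpose_mat (W_mat N q e) = W_mat N q e"
proof -
  let ?B = "B_mat N q e" and ?W = "W_mat N q e"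
  let ?A = "?B * transpose_mat ?B"
  have A: "?A \<in> carrier_mat N N" and At: "transpose_mat ?A = ?A"
    using B_mat_carrier[of N q e] by (auto simp: transpose_mult[of _ N N])
  have "transpose_mat ?W * ?A = transpose_mat (?A * ?W)"
    using W_mat_inverses(1) A by (subst transpose_mult[of _ N N]) (auto simp: At)
  then have "transpose_mat ?W * ?A = 1\<^sub>m N"
    using W_mat_inverses(2) by simp
  then have "transpose_mat ?W * (?A * ?W) = ?W"
    using W_mat_inverses(1) A by (subst assoc_mult_mat[symmetric, of _ N N _ N _ N]) auto
  then show ?thesis using W_mat_inverses(1,2) by simp
qed

lemma W_sym: "i \<in> {1..N} \<Longrightarrow> j \<in> {1..N} \<Longrightarrow> W N q e i j = W N q e j i"
  unfolding W_def using W_mat_inverses(1)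
  by (subst W_mat_symmetric[symmetric]) auto

text \<open>\<open>W B\<close> is the inverse of \<open>B\<^sup>T\<close>, hence lower triangular.\<close>

lemma W_mat_mult_B_mat:
  assumes "k < N" "k \<le> j" "j < N"
  shows "(W_mat N q e * B_mat N q e) $$ (k, j) = (if j = k then 1 / sqrt (q (j + 1)) else 0)"
  using assms(2,3)
\<comment> \<open>Induction from the last column backwards: entry \<open>(k, j)\<close> of
  \<open>(W B) B^T = 1\<close> involves only columns \<open>j\<close> and \<open>j + 1\<close> of
  \<open>W B\<close>.\<close>
proof (induction "N - j" arbitrary: j rule: less_induct)
  case less
  let ?B = "B_mat N q e" and ?W = "W_mat N q e"
  have Y: "?W * ?B \<in> carrier_mat N N" using W_mat_inverses(1) B_mat_carrier[of N q e] by simp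
  have "?W * ?B * transpose_mat ?B = 1\<^sub>m N"
    using W_mat_inverses(1,3) B_mat_carrier[of N q e] by (subst assoc_mult_mat[of _ N N _ N _ N]) auto
  then have "(?W * ?B * transpose_mat ?B) $$ (k, j) = (if k = j then 1 else 0)"
    using assms(1) less.prems by simp
  moreover have "(?W * ?B) $$ (k, j + 1) = 0" if "j + 1 \<noteq> N"
    using less.hyps[of "j + 1"] less.prems that by auto
  ultimately have "(?W * ?B) $$ (k, j) * sqrt (q (j + 1)) = (if k = j then 1 else 0)"
    using mult_transpose_B_mat_index[OF Y assms(1), of j q e] less.prems(2)
    by (auto split: if_splits)
  moreover have "sqrt (q (j + 1)) > 0" using q[of "j + 1"] less.prems by simp
  ultimately show ?case by (auto simp: field_simps split: if_splits)
qed

text \<open>The \<open>(i,j)\<close>-entry of \<open>W B\<close> vanishes above the diagonal and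
  combines only columns \<open>j - 1\<close> and \<open>j\<close> of \<open>W\<close>.\<close>

lemma W_column:
  assumes "1 \<le> i" "i < j" "j \<le> N"
  shows "W N q e i j = - sqrt (F_tilde q e j) * W N q e i (j - 1)"
proof -
  have "(W_mat N q e * B_mat N q e) $$ (i - 1, j - 1) = 0"
    using assms W_mat_mult_B_mat[of "i - 1" "j - 1"] by auto
  then have "W N q e i j * sqrt (q j) + W N q e i (j - 1) * sqrt (e (j - 1)) = 0"
    using assms mult_B_mat_index[OF W_mat_inverses(1), of "i - 1" "j - 1" q e]
    by (simp add: W_def)
  moreover have "sqrt (q j) > 0" using q[of j] assms by simp
  ultimately show ?thesis
    by (simp add: F_tilde_def real_sqrt_divide field_simps)
qed

text \<open>Identifies \<open>B_check 1\<close> with the only entry seen by walks confined to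
  \<open>{1}\<close>.\<close>

lemma W_first: "1 \<le> N \<Longrightarrow> W N q e 1 1 = 1 / q 1"
proof -
  assume N: "1 \<le> N"
  have "W N q e 1 1 * sqrt (q 1) = 1 / sqrt (q 1)"
    using N W_mat_mult_B_mat[of 0 0]
      mult_B_mat_index[OF W_mat_inverses(1), of 0 0 q e] by (simp add: W_def)
  moreover have "sqrt (q 1) * sqrt (q 1) = q 1" "sqrt (q 1) > 0"
    using q[of 1] N by auto
  ultimately show ?thesis by (metis eq_divide_eq mult.assoc less_irrefl mult_eq_0_iff)
qed

text \<open>Read off the diagonal of \<open>W B\<close>, then remove the off-diagonal entry by
  symmetry and \<open>W_column\<close>. The summand \<open>1 / q i\<close> becomes the weight
  \<open>d\<close> of the first-return decomposition.\<close>

lemma W_diag: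
  assumes "2 \<le> i" "i \<le> N" "0 \<le> e (i - 1)"
  shows "W N q e i i = F_tilde q e i * W N q e (i - 1) (i - 1) + 1 / q i"
proof -
  have "(W_mat N q e * B_mat N q e) $$ (i - 1, i - 1) = 1 / sqrt (q i)"
    using assms W_mat_mult_B_mat[of "i - 1" "i - 1"] by auto
  then have "W N q e i i * sqrt (q i) + W N q e i (i - 1) * sqrt (e (i - 1)) = 1 / sqrt (q i)"
    using assms mult_B_mat_index[OF W_mat_inverses(1), of "i - 1" "i - 1" q e]
    by (simp add: W_def)
  moreover have pos: "sqrt (q i) > 0" and qi: "q i > 0" using q[of i] assms by auto
  moreover have "W N q e i (i - 1) = - sqrt (F_tilde q e i) * W N q e (i - 1) (i - 1)"
    using assms W_sym[of i "i - 1"] W_column[of "i - 1" i] by (simp add: le_diff_conv2)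
  moreover define w where "w = W N q e (i - 1) (i - 1)"
  moreover define s t where "s = sqrt (q i)" and "t = sqrt (e (i - 1))"
  ultimately have "W N q e i i * s - t / s * w * t = 1 / s" "s > 0"
    by (auto simp: F_tilde_def real_sqrt_divide)
  moreover have "q i = s\<^sup>2" "e (i - 1) = t\<^sup>2"
    using qi assms(3) by (auto simp: s_def t_def)
  ultimately show ?thesis
    unfolding F_tilde_def w_def[symmetric] by (simp add: field_simps power2_eq_square)
qed

section \<open>Identification of g_tilde with walk sums\<close>

context
  assumes e: "\<And>i. 1 \<le> i \<Longrightarrow> i \<le> N - 1 \<Longrightarrow> e i > 0"
begin

lemma e_nonneg: "2 \<le> i \<Longrightarrow> i \<le> N \<Longrightarrow> 0 \<le> e (i - 1)"
  using e[of "i - 1"] by linarith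

lemma F_tilde_nonneg: "2 \<le> i \<Longrightarrow> i \<le> N \<Longrightarrow> 0 \<le> F_tilde q e i"
  using q[of i] e_nonneg[of i] by (simp add: F_tilde_def)

text \<open>Multiplied by \<open>F_tilde q e (m + 1)\<close>, this becomes the recursion for
  \<open>g_tilde\<close> at \<open>i = m + 1\<close>.\<close>

lemma walks_W_rec:
  assumes "2 \<le> m" "m \<le> N"
  shows "walks (W N q e) m (Suc r) m = 1 / q m * walks (W N q e) m r m
     + (\<Sum>k = 1..Suc r. F_tilde q e m * walks (W N q e) (m - 1) k (m - 1)
          * walks (W N q e) m (Suc r - k) m)"
proof -
  define c where "c = - sqrt (F_tilde q e m)"
  have F: "F_tilde q e m = c\<^sup>2"
    using F_tilde_nonneg assms by (simp add: c_def)
  show ?thesis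
    unfolding F
  proof (rule walks_first_return[OF assms(1)])
    fix j assume j: "1 \<le> j" "j < m"
    show "W N q e j m = c * W N q e j (m - 1)"
      using W_column[OF j assms(2)] by (simp add: c_def)
    then show "W N q e m j = c * W N q e (m - 1) j"
      using W_sym[of m j] W_sym[of "m - 1" j] j assms by (simp add: le_diff_conv2)
  qed (use W_diag[OF assms e_nonneg[OF assms]] F in simp)
qed

lemma g_tilde_eq_walks:
  assumes "2 \<le> i" "i \<le> N" "1 \<le> r"
  shows "g_tilde N q e i r = F_tilde q e i * walks (W N q e) (i - 1) r (i - 1)"
  using assms
proof (induction "i + r" arbitrary: i r rule: less_induct)
  case less
  show ?case
  proof (cases "r = 1")
    case True
    then show ?thesis using less.prems by (simp add: g_tilde_r1 walks_1 del: One_nat_def)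
  next
    case False
    then obtain s where s: "r = Suc s" "1 \<le> s" using less.prems by (cases r) auto
    let ?h = "walks (W N q e)" and ?m = "i - 1" and ?F = "F_tilde q e"
    have IH: "g_tilde N q e i (r - k) = ?F i * ?h ?m (r - k) ?m" if "1 \<le> k" "k < r" for k
      using less.hyps[of i "r - k"] less.prems that by auto
    have rec: "g_tilde N q e i r = ?F i * g_tilde N q e ?m r + B_check q ?m * g_tilde N q e i s
        + (\<Sum>k = 1..s. g_tilde N q e ?m k * g_tilde N q e i (r - k))"
      using g_tilde_rec[of i r N q e] less.prems s by simp
    show ?thesis
    proof (cases "i = 2")
      case True
      \<comment> \<open>Since \<open>g_tilde\<close> vanishes at index 1, only the
        \<open>B_check\<close> term of the recursion survives.\<close>
      have "?h 1 (Suc s) 1 = 1 / q 1 * ?h 1 s 1"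
        using W_first less.prems by (simp add: walks_Suc[of _ 1] del: One_nat_def)
      then show ?thesis
        using rec IH[of 1] True s by (simp add: g_tilde_1[simplified] B_check_def)
    next
      case False
      then have m: "2 \<le> ?m" "?m \<le> N" using less.prems by auto
      have IHm: "g_tilde N q e ?m k = ?F ?m * ?h (?m - 1) k (?m - 1)" if "1 \<le> k" "k \<le> r" for k
        using less.hyps[of ?m k] m less.prems(1) that by auto
      have "(\<Sum>k = 1..s. g_tilde N q e ?m k * g_tilde N q e i (r - k))
          = (\<Sum>k = 1..s. ?F i * (?F ?m * ?h (?m - 1) k (?m - 1) * ?h ?m (Suc s - k) ?m))"
        using s by (intro sum.cong refl, subst IH, simp, simp, subst IHm) auto
      \<comment> \<open>The summand \<open>k = Suc s\<close>, whose second walk has length 0 and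
        weight 1, absorbs the term \<open>?F i * g_tilde N q e ?m r\<close>.\<close>
      then have "g_tilde N q e i r = ?F i * (1 / q ?m * ?h ?m s ?m
          + (\<Sum>k = 1..Suc s. ?F ?m * ?h (?m - 1) k (?m - 1) * ?h ?m (Suc s - k) ?m))"
        using rec IH[of 1] IHm[of r] s
        by (simp add: B_check_def walks_0 sum_distrib_left algebra_simps)
      then show ?thesis using walks_W_rec[OF m, of s] s by simp
    qed
  qed
qed

text \<open>Replacing the endpoint \<open>i\<close> by \<open>i - 1\<close> on both sides costs
  \<open>- sqrt (F_tilde q e i)\<close> twice, which is the factor in
  \<open>g_tilde_eq_walks\<close>.\<close>

lemma g_tilde_eq_sum_walks:
  assumes "1 \<le> i" "i \<le> N"
  shows "g_tilde N q e i (n + 2)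
    = (\<Sum>a = 1..i - 1. W N q e i a * (walk_step {1..i - 1} (W N q e) ^^ n) (\<lambda>j. W N q e j i) a)"
proof (cases "i = 1")
  case True
  then show ?thesis by (simp add: g_tilde_1[simplified])
next
  case False
  then have i: "2 \<le> i" using assms by simp
  let ?W = "W N q e" and ?m = "i - 1" and ?c = "- sqrt (F_tilde q e i)"
  have col: "?W a i = ?c * ?W a ?m" if "a \<in> {1..?m}" for a
    using that W_column[of a i] assms by auto
  have row: "?W i a = ?c * ?W ?m a" if "a \<in> {1..?m}" for a
    using that col[OF that] W_sym[of i a] W_sym[of ?m a] assms by auto
  \<comment> \<open>Column \<open>i\<close> is \<open>?c\<close> times column \<open>?m\<close>,
    which is already a walk of length 1; linearity carries \<open>?c\<close> through every further
    step.\<close>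
  have "(walk_step {1..?m} ?W ^^ n) (\<lambda>j. ?W j i) a = ?c * walks ?W ?m (Suc n) a"
    if "a \<in> {1..?m}" for a using that
  proof (induction n arbitrary: a)
    case 0
    then show ?case using i col walks_1[of ?m ?W a] by simp
  next
    case (Suc n)
    have "(walk_step {1..?m} ?W ^^ Suc n) (\<lambda>j. ?W j i) a
        = (\<Sum>b = 1..?m. ?W a b * (?c * walks ?W ?m (Suc n) b))"
      unfolding walk_step_def[of "{1..?m}" ?W "(walk_step {1..?m} ?W ^^ n) (\<lambda>j. ?W j i)"]
        funpow.simps o_apply
      using Suc.IH by (intro sum.cong) auto
    then show ?case by (simp add: walks_Suc[of _ _ "Suc n"] sum_distrib_left mult_ac)
  qed
  then have "(\<Sum>a = 1..?m. ?W i a * (walk_step {1..?m} ?W ^^ n) (\<lambda>j. ?W j i) a)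
      = (\<Sum>a = 1..?m. ?c\<^sup>2 * (?W ?m a * walks ?W ?m (Suc n) a))"
    by (intro sum.cong refl) (simp only: row power2_eq_square mult_ac)
  also have "\<dots> = F_tilde q e i * walks ?W ?m (n + 2) ?m"
    using F_tilde_nonneg[of i] i assms by (simp add: sum_distrib_left walks_Suc[of _ _ "Suc n"])
  finally show ?thesis using g_tilde_eq_walks[of i "n + 2"] i assms by simp
qed

end

end

theorem theorem13:
  fixes N :: nat and q e :: "nat \<Rightarrow> real"
  assumes "N \<ge> 1"
    and "\<And>i. 1 \<le> i \<Longrightarrow> i \<le> N \<Longrightarrow> q i > 0"
    and "\<And>i. 1 \<le> i \<Longrightarrow> i \<le> N - 1 \<Longrightarrow> e i > 0"
  shows "\<forall>i\<in>{1..N}.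
      g_tilde N q e i 2 = (\<Sum>j1 = 1..i - 1. W N q e i j1 * W N q e j1 i)
    \<and> g_tilde N q e i 3 =
        (\<Sum>j1 = 1..i - 1. \<Sum>j2 = 1..i - 1. W N q e i j1 * W N q e j1 j2 * W N q e j2 i)
    \<and> (\<forall>M\<ge>4. g_tilde N q e i M =
        (\<Sum>j\<in>{1..M - 1} \<rightarrow>\<^sub>E {1..i - 1}.
           W N q e i (j 1) * (\<Prod>k = 1..M - 2. W N q e (j k) (j (k + 1))) * W N q e (j (M - 1)) i))"
proof
  fix i assume "i \<in> {1..N}"
  then have "1 \<le> i" "i \<le> N" by auto
  then have g: "g_tilde N q e i (n + 2) = (\<Sum>a = 1..i - 1.
      W N q e i a * (walk_step {1..i - 1} (W N q e) ^^ n) (\<lambda>j. W N q e j i) a)" for n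
    by (intro g_tilde_eq_sum_walks assms(2,3))
  have "g_tilde N q e i M =
        (\<Sum>j\<in>{1..M - 1} \<rightarrow>\<^sub>E {1..i - 1}.
           W N q e i (j 1) * (\<Prod>k = 1..M - 2. W N q e (j k) (j (k + 1))) * W N q e (j (M - 1)) i)"
    if "4 \<le> M" for M
  proof -
    \<comment> \<open>A tuple of \<open>M - 1\<close> indices has \<open>n\<close> inner
      factors.\<close>
    define n where "n = M - 2"
    then have n: "M = n + 2" using that by simp
    show ?thesis
      using g[of n] sum_PiE_walks[where n = n and A = "{1..i - 1}" and x = "W N q e i"
          and K = "W N q e" and y = "\<lambda>j. W N q e j i"]
      by (simp add: n)
  qed
  moreover have "g_tilde N q e i 2 = (\<Sum>j1 = 1..i - 1. W N q e i j1 * W N q e j1 i)"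
    using g[of 0] by (simp add: numeral_2_eq_2)
  moreover have "g_tilde N q e i 3 =
        (\<Sum>j1 = 1..i - 1. \<Sum>j2 = 1..i - 1. W N q e i j1 * W N q e j1 j2 * W N q e j2 i)"
    using g[of 1] by (simp add: walk_step_def sum_distrib_left mult.assoc numeral_3_eq_3)
  ultimately show "g_tilde N q e i 2 = (\<Sum>j1 = 1..i - 1. W N q e i j1 * W N q e j1 i)
    \<and> g_tilde N q e i 3 =
        (\<Sum>j1 = 1..i - 1. \<Sum>j2 = 1..i - 1. W N q e i j1 * W N q e j1 j2 * W N q e j2 i)
    \<and> (\<forall>M\<ge>4. g_tilde N q e i M =
        (\<Sum>j\<in>{1..M - 1} \<rightarrow>\<^sub>E {1..i - 1}.
           W N q e i (j 1) * (\<Prod>k = 1..M - 2. W N q e (j k) (j (k + 1))) * W N q e (j (M - 1)) i))"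
    by blast
qed

end
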